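(* Let $t\in[0,T]$ be fixed. Then $$\widehat{x}_\theta(t)\to\widehat{x}_0(t)\quad\text{as }\theta\to0,\qquad \widehat{x}_\theta(t)\to\widehat{x}_\infty(t)\quad\text{as }\theta\to\infty.$$ Moreover, $\theta\mapsto\widehat{x}_\theta(t)$ is continuous on $(0,\infty)$.
   Context: Setting. Fix $T>0$, $n,m,r\in\mathbb{N}$, $B\in\mathbb{R}^{n\times m}$, $C\in\mathbb{R}^{r\times n}$, $x_0\in\mathbb{R}^n$ and a measured output $y\in L^2(0,T;\mathbb{R}^r)$. $\|\cdot\|$ is the Euclidean norm, and $\|x\|_M^2=x^\top M x$ for a symmetric positive definite matrix $M$. Let $\Sigma=\Sigma_A\times\Sigma_\Gamma\times\Sigma_R\times\Sigma_Q$ be a product of finite nonempty sets, $\Sigma=\{\sigma_1,\dots,\sigma_N\}$, $N=|\Sigma|$. To each $\sigma=(\sigma_A,\sigma_\Gamma,\sigma_R,\sigma_Q)$ are assigned matrices $A_\sigma\in\mathbb{R}^{n\times n}$ (depending on $\sigma_A$ only) and symmetric positive definite matrices $\Gamma_\sigma\in\mathbb{R}^{n\times n}$, $R_\sigma\in\mathbb{R}^{m\times m}$, $Q_\sigma\in\mathbb{R}^{r\times r}$ (depending only on $\sigma_\Gamma$, $\sigma_R$, $\sigma_Q$ respectively). Index $k$ means $\sigma=\sigma_k$. For each $k$, $\Pi_k$ is the unique solution on $[0,T]$ of $\dot\Pi_k = A_k\Pi_k+\Pi_kA_k^\top-\Pi_kC^\top Q_k^{-1}C\Pi_k+BR_kB^\top$,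 $\Pi_k(0)=\Gamma_k$ (symmetric positive definite for all $t$), $P_k(t)=\Pi_k(t)^{-1}$ (infinitely differentiable in $t$), and $\widehat{x}_k\in H^1(0,T;\mathbb{R}^n)$ solves $\dot{\widehat{x}}_k=A_k\widehat{x}_k+\Pi_kC^\top Q_k^{-1}(y-C\widehat{x}_k)$, $\widehat{x}_k(0)=x_0$. Set $r_k(t)=\int_0^t\|y(s)-C\widehat{x}_k(s)\|_{Q_k^{-1}}^2\,ds$ and $\mathcal{V}_k(t,x)=\|x-\widehat{x}_k(t)\|_{P_k(t)}^2+r_k(t)$. Estimators (each minimizer over $x\in\mathbb{R}^n$ exists and is unique): $\widehat{x}_0(t)$ minimizes $\frac1N\sum_{k=1}^N\mathcal{V}_k(t,x)$; $\widehat{x}_\infty(t)$ minimizes $\max_{k=1,\dots,N}\mathcal{V}_k(t,x)$; and for $\theta\in(0,\infty)$, $\widehat{x}_\theta(t)$ minimizes $\frac1\theta\ln\left(\frac1N\sum_{k=1}^Ne^{\theta\mathcal{V}_k(t,x)}\right)$. *)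

theory Defs
  imports "HOL-Analysis.Analysis"
begin

definition sym_pos_def :: "real^'n^'n \<Rightarrow> bool" where
  "sym_pos_def M \<longleftrightarrow> transpose M = M \<and> (\<forall>x. x \<noteq> 0 \<longrightarrow> x \<bullet> (M *v x) > 0)"

definition wnorm_sq :: "real^'n^'n \<Rightarrow> real^'n \<Rightarrow> real" where
  "wnorm_sq M x = x \<bullet> (M *v x)"

definition in_L2 :: "real \<Rightarrow> (real \<Rightarrow> 'v::euclidean_space) \<Rightarrow> bool" where
  "in_L2 T f \<longleftrightarrow> set_borel_measurable lebesgue {0<..<T} f \<and>
     set_integrable lebesgue {0<..<T} (\<lambda>s. (norm (f s))\<^sup>2)"

text \<open>The space of smooth functions with compact support in the open interval \<open>(0, T)\<close>,
  each extended by zero to the whole line.\<close>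

definition test_function :: "real \<Rightarrow> (real \<Rightarrow> real) \<Rightarrow> bool" where
  "test_function T \<phi> \<longleftrightarrow> (\<forall>j. (deriv ^^ j) \<phi> differentiable_on UNIV) \<and>
     (\<exists>a b. 0 < a \<and> b < T \<and> (\<forall>s. s \<notin> {a..b} \<longrightarrow> \<phi> s = 0))"

text \<open>\<open>f\<close> belongs to \<open>H\<^sup>1(0, T)\<close> with weak derivative \<open>g\<close>. Elements of \<open>H\<^sup>1(0, T)\<close>
  are identified with their continuous representative on the closed interval, which is what
  gives point values such as \<open>f 0\<close> a meaning.\<close>

definition H1_with_deriv ::
    "real \<Rightarrow> (real \<Rightarrow> 'v::euclidean_space) \<Rightarrow> (real \<Rightarrow> 'v) \<Rightarrow> bool" where
  "H1_with_deriv T f g \<longleftrightarrow> continuous_on {0..T} f \<and> in_L2 T f \<and> in_L2 T g \<and>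
     (\<forall>\<phi>. test_function T \<phi> \<longrightarrow>
        (LINT s:{0<..<T}|lebesgue. deriv \<phi> s *\<^sub>R f s) =
        - (LINT s:{0<..<T}|lebesgue. \<phi> s *\<^sub>R g s))"

definition riccati_solution ::
    "real \<Rightarrow> real^'n^'n \<Rightarrow> real^'m^'n \<Rightarrow> real^'n^'r \<Rightarrow> real^'n^'n \<Rightarrow> real^'m^'m \<Rightarrow> real^'r^'r
      \<Rightarrow> (real \<Rightarrow> real^'n^'n) \<Rightarrow> bool" where
  "riccati_solution T A B C \<Gamma> R Q Ric \<longleftrightarrow> Ric 0 = \<Gamma> \<and>
     (\<forall>t\<in>{0..T}. (Ric has_vector_derivative
        A ** Ric t + Ric t ** transpose A - Ric t ** transpose C ** matrix_inv Q ** C ** Ric t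
          + B ** R ** transpose B) (at t within {0..T}))"

definition filter_solution ::
    "real \<Rightarrow> real^'n^'n \<Rightarrow> real^'n^'r \<Rightarrow> real^'r^'r \<Rightarrow> (real \<Rightarrow> real^'r) \<Rightarrow> real^'n
      \<Rightarrow> (real \<Rightarrow> real^'n^'n) \<Rightarrow> (real \<Rightarrow> real^'n) \<Rightarrow> bool" where
  "filter_solution T A C Q y x0 Ric xh \<longleftrightarrow> xh 0 = x0 \<and>
     H1_with_deriv T xh
       (\<lambda>t. A *v xh t + (Ric t ** transpose C ** matrix_inv Q) *v (y t - C *v xh t))"

definition residual ::
    "real^'n^'r \<Rightarrow> (real \<Rightarrow> real^'r) \<Rightarrow> real^'r^'r \<Rightarrow> (real \<Rightarrow> real^'n) \<Rightarrow> real \<Rightarrow> real" where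
  "residual C y Q xh t =
     (LINT s:{0..t}|lebesgue. wnorm_sq (matrix_inv Q) (y s - C *v xh s))"

text \<open>The parameter \<open>\<sigma> = (a, g, p, q)\<close> lists the components selecting, in this order,
  \<open>A\<close>, \<open>\<Gamma>\<close>, \<open>R\<close> and \<open>Q\<close>; the family \<open>Q\<close> is indexed by the last one only.\<close>

definition value_function ::
    "real^'n^'r \<Rightarrow> (real \<Rightarrow> real^'r) \<Rightarrow> ('q \<Rightarrow> real^'r^'r)
      \<Rightarrow> ('a \<times> 'g \<times> 'p \<times> 'q \<Rightarrow> real \<Rightarrow> real^'n^'n) \<Rightarrow> ('a \<times> 'g \<times> 'p \<times> 'q \<Rightarrow> real \<Rightarrow> real^'n)
      \<Rightarrow> 'a \<times> 'g \<times> 'p \<times> 'q \<Rightarrow> real \<Rightarrow> real^'n \<Rightarrow> real" where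
  "value_function C y Q Ric xh = (\<lambda>(a, g, p, q) t x.
     wnorm_sq (matrix_inv (Ric (a, g, p, q) t)) (x - xh (a, g, p, q) t)
       + residual C y (Q q) (xh (a, g, p, q)) t)"

definition estimator_zero :: "'s set \<Rightarrow> ('s \<Rightarrow> real \<Rightarrow> 'x \<Rightarrow> real) \<Rightarrow> real \<Rightarrow> 'x" where
  "estimator_zero S V t =
     arg_min (\<lambda>x. 1 / real (card S) * (\<Sum>\<sigma>\<in>S. V \<sigma> t x)) (\<lambda>x. True)"

definition estimator_infinity :: "'s set \<Rightarrow> ('s \<Rightarrow> real \<Rightarrow> 'x \<Rightarrow> real) \<Rightarrow> real \<Rightarrow> 'x" where
  "estimator_infinity S V t = arg_min (\<lambda>x. Max ((\<lambda>\<sigma>. V \<sigma> t x) ` S)) (\<lambda>x. True)"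

definition estimator :: "'s set \<Rightarrow> ('s \<Rightarrow> real \<Rightarrow> 'x \<Rightarrow> real) \<Rightarrow> real \<Rightarrow> real \<Rightarrow> 'x" where
  "estimator S V \<theta> t =
     arg_min (\<lambda>x. 1 / \<theta> * ln (1 / real (card S) * (\<Sum>\<sigma>\<in>S. exp (\<theta> * V \<sigma> t x)))) (\<lambda>x. True)"

end

theory Submission
  imports Defs
begin

text \<open>
  At a fixed time every value function is a quadratic form in \<open>x\<close> plus a constant. Its matrix is
  the inverse of a Riccati solution. Once that solution is known to be positive definite, the finite
  family of value functions is uniformly strongly convex, and the rest of the argument rests on
  this convexity.

  \<^bold>\<open>Positive definiteness.\<close> The antisymmetric part of a Riccati solution solves a linear equation
  with zero initial value, so Gronwall's inequality makes it vanish (\<open>riccati_flow_symmetric\<close>).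
  Given symmetry, the solution dominates \<open>\<epsilon> exp (- c s)\<close> times the identity for small \<open>\<epsilon>\<close> and large
  \<open>c\<close>: at a first time where this fails, a unit vector \<open>x\<close> is an eigenvector, the quadratic terms
  of the equation are then explicit, and the difference of the two forms at \<open>x\<close> has positive
  derivative although it has just decreased to zero (\<open>riccati_flow_pos_def\<close>).

  \<^bold>\<open>Comparison of minimisers.\<close> Write \<open>f\<^sub>\<theta>\<close> for the log-mean-exp objective, \<open>f\<^sub>0\<close> for the mean and
  \<open>f\<^sub>\<infinity>\<close> for the maximum. All of these are monotone and convex functions of the vector of values
  and commute with adding a constant, so they inherit strong convexity with the same modulus
  \<open>\<kappa>\<close>. Hence each has a minimiser, and the squared distance of a point from it is at most the excess
  of the objective over the minimum, divided by \<open>2 \<kappa>\<close>. It remains to bound the excess of the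
  \<open>\<theta>\<close>-minimiser \<open>x\<^sub>\<theta>\<close>, where \<open>f\<^sub>0 \<le> f\<^sub>\<theta> \<le> f\<^sub>\<infinity> \<le> f\<^sub>\<theta> + ln N / \<theta>\<close> is the basic chain.

  \<^item> For \<open>f\<^sub>0\<close>, the excess is at most \<open>f\<^sub>\<theta> - f\<^sub>0\<close> evaluated at the minimiser of \<open>f\<^sub>0\<close>. Pointwise
    convergence at that one point is enough.
  \<^item> For \<open>f\<^sub>\<infinity>\<close>, the excess is at most \<open>ln N / \<theta>\<close>.
  \<^item> For \<open>f\<^sub>\<alpha>\<close> with \<open>\<theta>\<close> near \<open>\<alpha>\<close>, the chain confines all \<open>x\<^sub>\<theta>\<close> to one ball, on which the values are
    bounded by some \<open>M\<close>. There \<open>\<theta> f\<^sub>\<theta>\<close> is Lipschitz in \<open>\<theta>\<close> with constant \<open>M\<close>, and the excess is at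
    most \<open>2 M \<bar>\<theta> - \<alpha>\<bar> / \<alpha>\<close>.
\<close>

section \<open>Matrix calculus\<close>

lemma matrix_add_rdistrib: "(M + N) ** P = M ** P + N ** (P :: 'a::semiring_1^'k^'n)"
  by (simp add: vec_eq_iff matrix_matrix_mult_def sum.distrib distrib_right)

lemma bounded_bilinear_matrix_matrix_mult:
  "bounded_bilinear ((**) :: real^'n^'m \<Rightarrow> real^'k^'n \<Rightarrow> real^'k^'m)"
proof -
  have "bilinear ((**) :: real^'n^'m \<Rightarrow> real^'k^'n \<Rightarrow> real^'k^'m)"
    unfolding bilinear_def
    by (auto intro!: linearI simp: matrix_add_ldistrib matrix_add_rdistrib scalar_matrix_assoc matrix_scalar_ac)
  then show ?thesis
    by (simp add: bilinear_conv_bounded_bilinear)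
qed

lemma bounded_bilinear_matrix_vector_mult:
  "bounded_bilinear ((*v) :: real^'n^'m \<Rightarrow> real^'n \<Rightarrow> real^'m)"
proof -
  have "bilinear ((*v) :: real^'n^'m \<Rightarrow> real^'n \<Rightarrow> real^'m)"
    unfolding bilinear_def
    by (auto intro!: linearI simp: matrix_vector_right_distrib matrix_vector_mult_add_rdistrib
        scaleR_matrix_vector_assoc matrix_vector_mult_scaleR)
  then show ?thesis
    by (simp add: bilinear_conv_bounded_bilinear)
qed

lemma transpose_add: "transpose (M + N) = transpose M + transpose (N :: 'a::plus^'n^'m)"
  by (simp add: transpose_def vec_eq_iff)

lemma transpose_diff: "transpose (M - N) = transpose M - transpose (N :: 'a::minus^'n^'m)"
  by (simp add: transpose_def vec_eq_iff)

lemma bounded_linear_transpose: "bounded_linear (transpose :: real^'n^'m \<Rightarrow> real^'m^'n)"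
proof -
  have "linear (transpose :: real^'n^'m \<Rightarrow> real^'m^'n)"
    by (auto intro!: linearI simp: transpose_add transpose_scalar)
  then show ?thesis
    by (simp add: linear_conv_bounded_linear)
qed

lemma inner_transpose_matrix_vector: "x \<bullet> (transpose M *v z) = (M *v x) \<bullet> (z :: real^'n)"
  by (metis dot_lmul_matrix inner_commute transpose_transpose vector_transpose_matrix)

lemma bounded_quadratic_form: "\<exists>a. \<forall>x. x \<bullet> (M *v x) \<le> a * (x \<bullet> (x :: real^'n))"
proof -
  obtain a where a: "\<And>x. norm (M *v x) \<le> norm x * a"
    using bounded_linear.pos_bounded[OF matrix_vector_mul_bounded_linear[of M]] by blast
  have "x \<bullet> (M *v x) \<le> a * (x \<bullet> x)" for x
  proof -
    have "x \<bullet> (M *v x) \<le> norm x * norm (M *v x)"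
      by (rule norm_cauchy_schwarz)
    also have "\<dots> \<le> norm x * (norm x * a)"
      by (intro mult_left_mono a) auto
    finally show ?thesis
      by (simp add: dot_square_norm power2_eq_square mult_ac)
  qed
  then show ?thesis by blast
qed

lemma positive_quadratic_form_coercive:
  fixes M :: "real^'n^'n"
  assumes pos: "\<And>x. x \<noteq> 0 \<Longrightarrow> x \<bullet> (M *v x) > 0"
  shows "\<exists>\<mu>>0. \<forall>x. \<mu> * (x \<bullet> x) \<le> x \<bullet> (M *v x)"
proof -
  let ?S = "sphere (0 :: real^'n) 1"
  have "continuous_on ?S (\<lambda>x. x \<bullet> (M *v x))"
    by (intro continuous_intros)
  then obtain u where u: "u \<in> ?S" and min: "\<And>x. x \<in> ?S \<Longrightarrow> u \<bullet> (M *v u) \<le> x \<bullet> (M *v x)"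
    using continuous_attains_inf[of ?S "\<lambda>x. x \<bullet> (M *v x)"] by (auto simp: sphere_eq_empty)
  let ?\<mu> = "u \<bullet> (M *v u)"
  have "?\<mu> * (x \<bullet> x) \<le> x \<bullet> (M *v x)" for x
  proof (cases "x = 0")
    case False
    define z where "z = x /\<^sub>R norm x"
    have x: "x = norm x *\<^sub>R z" and "z \<in> ?S"
      using False by (auto simp: z_def)
    have "x \<bullet> (M *v x) = (norm x)\<^sup>2 * (z \<bullet> (M *v z))"
      by (subst (1 2) x) (simp add: matrix_vector_mult_scaleR power2_eq_square)
    moreover have "?\<mu> \<le> z \<bullet> (M *v z)"
      using \<open>z \<in> ?S\<close> by (rule min)
    ultimately show ?thesis
      by (simp add: dot_square_norm mult.commute[of _ "(norm x)\<^sup>2"] mult_left_mono)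
  qed simp
  moreover have "?\<mu> > 0"
    using u by (intro pos) auto
  ultimately show ?thesis by blast
qed

text \<open>Moving from \<open>x\<close> a short way against \<open>M *v x\<close> changes the form by a negative first-order term, so
  the form would become negative unless \<open>M *v x\<close> vanishes.\<close>

lemma psd_form_zero_imp_kernel:
  fixes M :: "real^'n^'n"
  assumes sym: "transpose M = M" and psd: "\<And>z. 0 \<le> z \<bullet> (M *v z)" and zero: "x \<bullet> (M *v x) = 0"
  shows "M *v x = 0"
proof (rule ccontr)
  assume "M *v x \<noteq> 0"
  let ?w = "M *v x"
  let ?q = "?w \<bullet> (M *v ?w)"
  have ww: "?w \<bullet> ?w > 0" using \<open>M *v x \<noteq> 0\<close> by simp
  have cross: "x \<bullet> (M *v ?w) = ?w \<bullet> ?w"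
    using inner_transpose_matrix_vector[of x M ?w] sym by simp
  have expand: "(x - e *\<^sub>R ?w) \<bullet> (M *v (x - e *\<^sub>R ?w)) = e\<^sup>2 * ?q - 2 * e * (?w \<bullet> ?w)" for e
    using zero cross
    by (simp add: matrix_vector_mult_diff_distrib matrix_vector_mult_scaleR inner_diff_left
        inner_diff_right power2_eq_square inner_commute algebra_simps)
  \<comment> \<open>small enough that the second-order term stays below the first-order one; adding 1 keeps the
    denominator positive when the form vanishes at \<open>?w\<close>\<close>
  define e where "e = (?w \<bullet> ?w) / (?q + 1)"
  have q: "?q \<ge> 0" by (rule psd)
  have "e > 0" using ww q by (simp add: e_def)
  have "e * ?q < 2 * (?w \<bullet> ?w)"
  proof -
    have "e * ?q \<le> e * (?q + 1)" using \<open>e > 0\<close> by simp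
    also have "\<dots> = ?w \<bullet> ?w" using q by (simp add: e_def)
    finally show ?thesis using ww by linarith
  qed
  then have "e * (e * ?q - 2 * (?w \<bullet> ?w)) < 0"
    using \<open>e > 0\<close> by (simp add: mult_less_0_iff)
  with psd[of "x - e *\<^sub>R ?w"] show False
    unfolding expand by (simp add: power2_eq_square algebra_simps)
qed

lemma sym_pos_def_imp_invertible:
  fixes M :: "real^'n^'n"
  assumes "sym_pos_def M"
  shows "invertible M"
proof -
  have "x = 0" if "M *v x = 0" for x
    using assms that unfolding sym_pos_def_def by force
  then show ?thesis
    using matrix_left_invertible_ker invertible_left_inverse by blast
qed

lemma matrix_inv_mult:
  fixes M :: "real^'n^'n"
  assumes "invertible M"
  shows "M ** matrix_inv M = mat 1" "matrix_inv M ** M = mat 1"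
  using assms unfolding invertible_def matrix_inv_def
  by (auto intro: someI2_ex)

lemma transpose_matrix_inv:
  fixes M :: "real^'n^'n"
  assumes "sym_pos_def M"
  shows "transpose (matrix_inv M) = matrix_inv M"
proof -
  have inv: "invertible M" by (rule sym_pos_def_imp_invertible[OF assms])
  have "transpose (matrix_inv M) ** M = mat 1"
    using arg_cong[OF matrix_inv_mult(1)[OF inv], of transpose] assms
    by (simp add: matrix_transpose_mul sym_pos_def_def)
  then have "transpose (matrix_inv M) ** (M ** matrix_inv M) = matrix_inv M"
    by (simp add: matrix_mul_assoc)
  then show ?thesis
    by (simp add: matrix_inv_mult[OF inv])
qed

lemma matrix_inv_form_pos:
  fixes M :: "real^'n^'n"
  assumes "sym_pos_def M" "x \<noteq> 0"
  shows "x \<bullet> (matrix_inv M *v x) > 0"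
proof -
  let ?z = "matrix_inv M *v x"
  have "M *v ?z = x"
    by (simp add: matrix_vector_mul_assoc matrix_inv_mult[OF sym_pos_def_imp_invertible[OF assms(1)]])
  then have "?z \<noteq> 0" and "?z \<bullet> (M *v ?z) = x \<bullet> ?z"
    using assms(2) by (auto simp: inner_commute)
  then show ?thesis
    using assms(1) unfolding sym_pos_def_def by metis
qed

section \<open>The Riccati flow preserves symmetric positive definite matrices\<close>

lemma gronwall_nonpos:
  fixes \<phi> :: "real \<Rightarrow> real"
  assumes deriv: "\<And>s. s \<in> {0..T} \<Longrightarrow> (\<phi> has_real_derivative \<phi>' s) (at s within {0..T})"
    and le: "\<And>s. s \<in> {0..T} \<Longrightarrow> \<phi>' s \<le> c * \<phi> s"
    and "\<phi> 0 \<le> 0" and t: "t \<in> {0..T}"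
  shows "\<phi> t \<le> 0"
proof -
  let ?\<psi> = "\<lambda>s. exp (- (c * s)) * \<phi> s"
  have D: "(?\<psi> has_real_derivative exp (- (c * s)) * (\<phi>' s - c * \<phi> s)) (at s within {0..T})"
    if "s \<in> {0..T}" for s
    by (rule derivative_eq_intros deriv that refl)+ (simp add: algebra_simps)
  have cont: "continuous_on {0..T} ?\<psi>"
    by (rule DERIV_continuous_on) (rule D)
  have "?\<psi> t \<le> ?\<psi> 0"
  proof (rule DERIV_nonpos_imp_decreasing_open[where f = ?\<psi> and a = 0 and b = t])
    show "continuous_on {0..t} ?\<psi>"
      using t by (intro continuous_on_subset[OF cont]) auto
    fix s assume s: "0 < s" "s < t"
    then have "(?\<psi> has_real_derivative exp (- (c * s)) * (\<phi>' s - c * \<phi> s)) (at s)"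
      using D[of s] t by (simp add: at_within_Icc_at)
    moreover have "exp (- (c * s)) * (\<phi>' s - c * \<phi> s) \<le> 0"
      using le[of s] s t by (intro mult_nonneg_nonpos) auto
    ultimately show "\<exists>d. DERIV ?\<psi> s :> d \<and> d \<le> 0" by blast
  qed (use t in auto)
  also have "\<dots> \<le> 0" using \<open>\<phi> 0 \<le> 0\<close> by simp
  finally show ?thesis
    by (simp add: mult_le_0_iff)
qed

text \<open>
  If \<open>K\<close> and \<open>W\<close> are symmetric, the transpose of a solution is again a solution. The difference
  \<open>D\<close> of the two satisfies the linear equation \<open>D' = G D + D G\<^sup>T\<close> with \<open>G = A - X\<^sup>T K\<close>, whose
  coefficient is bounded on the compact time interval. Gronwall applied to the squared norm of
  \<open>D\<close> finishes the argument.\<close>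

lemma riccati_flow_symmetric:
  fixes X :: "real \<Rightarrow> real^'n^'n"
  assumes ric: "\<And>s. s \<in> {0..T} \<Longrightarrow>
      (X has_vector_derivative A ** X s + X s ** transpose A - X s ** K ** X s + W) (at s within {0..T})"
    and K: "transpose K = K" and W: "transpose W = W" and X0: "transpose (X 0) = X 0"
    and t: "t \<in> {0..T}"
  shows "transpose (X t) = X t"
proof -
  note mm = bounded_bilinear_matrix_matrix_mult
  define D where "D s = X s - transpose (X s)" for s
  define G where "G s = A - transpose (X s) ** K" for s
  have contX: "continuous_on {0..T} X"
    by (rule continuous_on_vector_derivative) (rule ric)
  have "continuous_on {0..T} G"
    unfolding G_def
    by (intro continuous_intros bounded_bilinear.continuous_on[OF mm]
        bounded_linear.continuous_on[OF bounded_linear_transpose] contX)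
  then have "compact (G ` {0..T})"
    by (intro compact_continuous_image) auto
  then obtain g where g: "\<And>s. s \<in> {0..T} \<Longrightarrow> norm (G s) \<le> g"
    using compact_imp_bounded bounded_iff by (metis imageI)
  obtain b where b: "b > 0" "\<And>(M :: real^'n^'n) (N :: real^'n^'n). norm (M ** N) \<le> norm M * norm N * b"
    using bounded_bilinear.pos_bounded[OF mm] by blast
  have tr_le: "norm (transpose M) \<le> norm M" for M :: "real^'n^'n"
  proof -
    have "transpose M \<bullet> transpose M = M \<bullet> M"
      unfolding inner_vec_def transpose_def by (simp, rule sum.swap)
    then show ?thesis by (simp add: norm_eq_sqrt_inner)
  qed
  have D': "(D has_vector_derivative G s ** D s + D s ** transpose (G s)) (at s within {0..T})"
    if "s \<in> {0..T}" for s
  proof -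
    let ?X = "X s" and ?Y = "transpose (X s)"
    have "(D has_vector_derivative (A ** ?X + ?X ** transpose A - ?X ** K ** ?X + W)
        - transpose (A ** ?X + ?X ** transpose A - ?X ** K ** ?X + W)) (at s within {0..T})"
      unfolding D_def
      by (intro has_vector_derivative_diff ric that
          bounded_linear.has_vector_derivative[OF bounded_linear_transpose])
    also have "(A ** ?X + ?X ** transpose A - ?X ** K ** ?X + W)
        - transpose (A ** ?X + ?X ** transpose A - ?X ** K ** ?X + W)
        = G s ** D s + D s ** transpose (G s)"
      by (simp add: D_def G_def transpose_add transpose_diff matrix_transpose_mul K W
          bounded_bilinear.diff_left[OF mm] bounded_bilinear.diff_right[OF mm] matrix_mul_assoc)
    finally show ?thesis .
  qed
  have "D t \<bullet> D t \<le> 0"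
  proof (rule gronwall_nonpos[where c = "4 * g * b" and T = T and \<phi> = "\<lambda>s. D s \<bullet> D s" and
        \<phi>' = "\<lambda>s. 2 * (D s \<bullet> (G s ** D s + D s ** transpose (G s)))"])
    fix s assume s: "s \<in> {0..T}"
    show "((\<lambda>s. D s \<bullet> D s) has_real_derivative 2 * (D s \<bullet> (G s ** D s + D s ** transpose (G s))))
        (at s within {0..T})"
      using bounded_bilinear.has_vector_derivative[OF bounded_bilinear_inner D'[OF s] D'[OF s]]
      by (simp add: has_real_derivative_iff_has_vector_derivative inner_commute)
    have bd: "D s \<bullet> M \<le> g * b * (D s \<bullet> D s)" if "norm M \<le> norm (G s) * norm (D s) * b" for M
    proof -
      have "D s \<bullet> M \<le> norm (D s) * norm M" by (rule norm_cauchy_schwarz)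
      also have "\<dots> \<le> norm (D s) * (g * norm (D s) * b)"
        using order_trans[OF that mult_right_mono[OF mult_right_mono[OF g[OF s]]]] b
        by (intro mult_left_mono) auto
      finally show ?thesis
        by (simp add: dot_square_norm power2_eq_square mult_ac)
    qed
    have "norm (D s ** transpose (G s)) \<le> norm (G s) * norm (D s) * b"
    proof -
      have "norm (D s ** transpose (G s)) \<le> norm (D s) * norm (transpose (G s)) * b" by (rule b)
      also have "\<dots> \<le> norm (D s) * norm (G s) * b"
        using b tr_le by (intro mult_right_mono mult_left_mono) auto
      finally show ?thesis by (simp add: mult_ac)
    qed
    from bd[OF b(2)] bd[OF this]
    show "2 * (D s \<bullet> (G s ** D s + D s ** transpose (G s))) \<le> 4 * g * b * (D s \<bullet> D s)"
      by (simp add: inner_add_right)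
  qed (use t X0 in \<open>auto simp: D_def\<close>)
  then show ?thesis
    by (simp add: D_def inner_gt_zero_iff[symmetric] not_less[symmetric] del: inner_gt_zero_iff)
      (metis eq_iff_diff_eq_0 inner_gt_zero_iff)
qed

text \<open>
  Compare \<open>X\<close> with the multiple \<open>\<rho> = \<epsilon> exp (- c s)\<close> of the identity. At the first time where
  \<open>X - \<rho> I\<close> ceases to be positive definite it is still positive semidefinite and has a unit kernel
  vector \<open>x\<close>, that is, \<open>X x = \<rho> x\<close>. Substituting this in the equation, the derivative of the form of
  \<open>X - \<rho> I\<close> at \<open>x\<close> is \<open>\<rho> (2 x\<cdot>A x - \<rho> x\<cdot>K x + c) + x\<cdot>W x\<close>. As \<open>\<rho> \<le> 1\<close>, a constant \<open>c\<close> depending only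
  on \<open>A\<close> and \<open>K\<close> makes it positive, although the form was positive before and is zero now.\<close>

lemma riccati_flow_pos_def:
  fixes X :: "real \<Rightarrow> real^'n^'n"
  assumes ric: "\<And>s. s \<in> {0..T} \<Longrightarrow>
      (X has_vector_derivative A ** X s + X s ** transpose A - X s ** K ** X s + W) (at s within {0..T})"
    and K: "transpose K = K" and W: "transpose W = W" and W_psd: "\<And>x. 0 \<le> x \<bullet> (W *v x)"
    and X0: "sym_pos_def (X 0)" and t: "t \<in> {0..T}"
  shows "sym_pos_def (X t)"
proof -
  have sym: "transpose (X s) = X s" if "s \<in> {0..T}" for s
    using riccati_flow_symmetric[OF ric K W _ that] X0 by (simp add: sym_pos_def_def)
  obtain a where a: "\<And>x. x \<bullet> ((- A) *v x) \<le> a * (x \<bullet> x)"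
    using bounded_quadratic_form[of "- A"] by blast
  obtain k where k: "\<And>x. x \<bullet> (K *v x) \<le> k * (x \<bullet> x)"
    using bounded_quadratic_form by blast
  obtain \<mu> where \<mu>: "\<mu> > 0" "\<And>x. \<mu> * (x \<bullet> x) \<le> x \<bullet> (X 0 *v x)"
    using positive_quadratic_form_coercive[of "X 0"] X0 unfolding sym_pos_def_def by blast
  \<comment> \<open>at most 1 so that \<open>\<rho> \<le> 1\<close> below, and less than \<open>\<mu>\<close> so that the comparison holds at time 0\<close>
  define \<epsilon> where "\<epsilon> = min 1 (\<mu> / 2)"
  have \<epsilon>: "0 < \<epsilon>" "\<epsilon> \<le> 1" "\<epsilon> < \<mu>" using \<mu>(1) by (auto simp: \<epsilon>_def)
  define c where "c = 2 * \<bar>a\<bar> + \<bar>k\<bar> + 1"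
  define h where "h s x = x \<bullet> (X s *v x) - \<epsilon> * exp (- (c * s)) * (x \<bullet> x)" for s and x :: "real^'n"
  have contX: "continuous_on {0..T} X"
    by (rule continuous_on_vector_derivative) (rule ric)
  let ?S = "sphere (0 :: real^'n) 1"
  let ?Z = "({0..T} \<times> ?S) \<inter> (\<lambda>(s, x). h s x) -` {..0}"
  have cont: "continuous_on ({0..T} \<times> ?S) (\<lambda>(s, x). h s x)"
    unfolding h_def case_prod_unfold
    by (intro continuous_intros bounded_bilinear.continuous_on[OF bounded_bilinear_matrix_vector_mult]
        continuous_on_compose2[OF contX]) auto
  have "closed ?Z"
    by (rule continuous_closed_preimage[OF cont]) (auto intro!: closed_Times)
  then have "compact (({0..T} \<times> ?S) \<inter> ?Z)"
    by (intro compact_Int_closed compact_Times) auto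
  then have "compact ?Z" by (simp add: Int_absorb1 Int_assoc)
  have "?Z = {}"
  proof (rule ccontr)
    assume "?Z \<noteq> {}"
    then obtain p where "p \<in> ?Z" and first: "\<And>q. q \<in> ?Z \<Longrightarrow> fst p \<le> fst q"
      using continuous_attains_inf[OF \<open>compact ?Z\<close>, of fst] continuous_on_fst[OF continuous_on_id]
      by blast
    then obtain s x where s: "s \<in> {0..T}" and x: "norm x = 1" and hx: "h s x \<le> 0" and p: "p = (s, x)"
      by auto
    have before: "h r z > 0" if "0 \<le> r" "r < s" "norm z = 1" for r z
      using first[of "(r, z)"] that s p by (force simp: not_le)
    have at0: "h 0 z > 0" if "norm z = 1" for z
      using \<mu>(2)[of z] \<epsilon>(3) that by (simp add: h_def dot_square_norm)
    have "s > 0" using at0[OF x] hx s by (cases "s = 0") auto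
    \<comment> \<open>a negative value now would force a zero strictly before the first such time\<close>
    have nonneg: "h s z \<ge> 0" if z: "norm z = 1" for z
    proof (rule ccontr)
      assume "\<not> h s z \<ge> 0"
      then have neg: "h s z < 0" by simp
      have "continuous_on {0..s} (\<lambda>r. h r z)"
      proof -
        have "continuous_on {0..s} (\<lambda>r. case (r, z) of (s, x) \<Rightarrow> h s x)"
          using s z by (intro continuous_on_compose2[OF cont] continuous_intros) auto
        then show ?thesis by simp
      qed
      then obtain r where r: "0 \<le> r" "r \<le> s" "h r z = 0"
        using IVT2'[of "\<lambda>r. h r z" s 0 0] neg at0[OF z] \<open>s > 0\<close> by auto
      then have "r < s" using neg by (cases "r = s") auto
      then show False using before[of r z] r z by simp
    qed
    have h0: "h s x = 0" using hx nonneg[OF x] by simp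
    define \<rho> where "\<rho> = \<epsilon> * exp (- (c * s))"
    have "0 \<le> c" by (simp add: c_def)
    then have \<rho>: "0 < \<rho>" "\<rho> \<le> 1"
      using \<epsilon> s by (auto simp: \<rho>_def intro!: mult_le_one)
    let ?M = "X s - \<rho> *\<^sub>R mat 1"
    have Mv: "?M *v z = X s *v z - \<rho> *\<^sub>R z" for z
      by (simp add: matrix_vector_mult_diff_rdistrib scaleR_matrix_vector_assoc[symmetric])
    have hM: "h s z = z \<bullet> (?M *v z)" for z
      unfolding Mv by (simp add: h_def \<rho>_def inner_diff_right)
    have "?M *v x = 0"
    proof (rule psd_form_zero_imp_kernel)
      show "transpose ?M = ?M"
        by (simp add: transpose_diff transpose_scalar sym[OF s])
      show "x \<bullet> (?M *v x) = 0" using h0 hM by simp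
      fix z
      show "0 \<le> z \<bullet> (?M *v z)"
      proof (cases "z = 0")
        case False
        define u where "u = z /\<^sub>R norm z"
        have z: "z = norm z *\<^sub>R u" and "norm u = 1" using False by (auto simp: u_def)
        have "0 \<le> u \<bullet> (?M *v u)" using nonneg[OF \<open>norm u = 1\<close>] hM by simp
        then show ?thesis
          by (subst (1 2) z) (simp add: matrix_vector_mult_scaleR)
      qed simp
    qed
    then have eig: "X s *v x = \<rho> *\<^sub>R x" using Mv[of x] by simp
    let ?X' = "A ** X s + X s ** transpose A - X s ** K ** X s + W"
    let ?d = "x \<bullet> (?X' *v x) + c * \<rho>"
    have deriv: "((\<lambda>r. h r x) has_real_derivative ?d) (at s within {0..T})"
    proof -
      have "bounded_linear (\<lambda>M. x \<bullet> (M *v x))"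
        by (intro bounded_linear_inner_right_comp
            bounded_bilinear.bounded_linear_left[OF bounded_bilinear_matrix_vector_mult])
      from bounded_linear.has_vector_derivative[OF this ric[OF s]]
      have "((\<lambda>r. x \<bullet> (X r *v x)) has_real_derivative x \<bullet> (?X' *v x)) (at s within {0..T})"
        by (simp add: has_real_derivative_iff_has_vector_derivative)
      moreover have "((\<lambda>r. \<epsilon> * exp (- (c * r)) * (x \<bullet> x)) has_real_derivative - (c * \<rho>)) (at s within {0..T})"
        using x by (auto intro!: derivative_eq_intros simp: \<rho>_def dot_square_norm)
      ultimately show ?thesis
        unfolding h_def using DERIV_diff by fastforce
    qed
    have xx: "x \<bullet> x = 1" using x by (simp add: dot_square_norm)
    have "?d = \<rho> * (2 * (x \<bullet> (A *v x)) - \<rho> * (x \<bullet> (K *v x)) + c) + x \<bullet> (W *v x)"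
    proof -
      have 1: "x \<bullet> ((A ** X s) *v x) = \<rho> * (x \<bullet> (A *v x))"
        by (simp add: matrix_vector_mul_assoc[symmetric] eig matrix_vector_mult_scaleR)
      have Xs: "x \<bullet> (X s *v z) = \<rho> * (x \<bullet> z)" for z
        using inner_transpose_matrix_vector[of x "X s" z] sym[OF s] eig by simp
      have 2: "x \<bullet> ((X s ** transpose A) *v x) = \<rho> * (x \<bullet> (A *v x))"
        by (simp add: matrix_vector_mul_assoc[symmetric] Xs inner_transpose_matrix_vector inner_commute
            del: transpose_matrix_vector)
      have 3: "x \<bullet> ((X s ** K ** X s) *v x) = \<rho>\<^sup>2 * (x \<bullet> (K *v x))"
        by (simp add: matrix_vector_mul_assoc[symmetric] eig Xs matrix_vector_mult_scaleR power2_eq_square)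
      show ?thesis
        using 1 2 3
        by (simp add: matrix_vector_mult_add_rdistrib matrix_vector_mult_diff_rdistrib inner_add_right
            inner_diff_right power2_eq_square algebra_simps)
    qed
    moreover have "2 * (x \<bullet> (A *v x)) - \<rho> * (x \<bullet> (K *v x)) + c > 0"
    proof -
      have "- (x \<bullet> (A *v x)) \<le> \<bar>a\<bar>"
        using a[of x] xx by (simp add: bounded_bilinear.minus_left[OF bounded_bilinear_matrix_vector_mult])
      moreover have "\<rho> * (x \<bullet> (K *v x)) \<le> \<bar>k\<bar>"
      proof -
        have "\<rho> * (x \<bullet> (K *v x)) \<le> \<rho> * \<bar>k\<bar>"
          using k[of x] xx \<rho> by (intro mult_left_mono) auto
        also have "\<dots> \<le> \<bar>k\<bar>" using \<rho> by (intro mult_left_le_one_le) auto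
        finally show ?thesis .
      qed
      ultimately show ?thesis by (simp add: c_def)
    qed
    ultimately have "?d > 0"
      using \<rho> W_psd[of x] by (simp add: add_pos_nonneg)
    from has_real_derivative_pos_inc_left[OF deriv this]
    obtain \<delta> where \<delta>: "\<delta> > 0" "\<And>r. \<lbrakk>r > 0; s - r \<in> {0..T}; r < \<delta>\<rbrakk> \<Longrightarrow> h (s - r) x < h s x"
      by blast
    define r where "r = min s \<delta> / 2"
    have "r > 0" "s - r \<in> {0..T}" "r < \<delta>" "s - r < s"
      using \<open>s > 0\<close> \<delta>(1) s by (auto simp: r_def min_def)
    then show False
      using \<delta>(2)[of r] before[of "s - r" x] x h0 by auto
  qed
  have "x \<bullet> (X t *v x) > 0" if "x \<noteq> 0" for x
  proof -
    define u where "u = x /\<^sub>R norm x"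
    have xu: "x = norm x *\<^sub>R u" and u: "norm u = 1" using that by (auto simp: u_def)
    have "(t, u) \<notin> ?Z" using \<open>?Z = {}\<close> by blast
    then have "h t u > 0" using t u by auto
    moreover have "\<epsilon> * exp (- (c * t)) * (u \<bullet> u) \<ge> 0" using \<epsilon> by simp
    ultimately have "u \<bullet> (X t *v u) > 0" unfolding h_def by linarith
    then show ?thesis
      using that by (subst (1 2) xu) (simp add: matrix_vector_mult_scaleR)
  qed
  then show ?thesis
    using sym[OF t] by (simp add: sym_pos_def_def)
qed

section \<open>Midpoint strong convexity and its minimisers\<close>

text \<open>
  Testing midpoints alone is enough for the quadratic growth away from a minimiser, and it turns
  convexity of log-mean-exp into a single application of the Cauchy-Schwarz inequality.\<close>

definition midpoint_strongly_convex :: "real \<Rightarrow> ('x::real_normed_vector \<Rightarrow> real) \<Rightarrow> bool" where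
  "midpoint_strongly_convex \<kappa> f \<longleftrightarrow>
     (\<forall>x z. f (midpoint x z) \<le> f x / 2 + f z / 2 - \<kappa> * (dist x z)\<^sup>2)"

lemma midpoint_strongly_convex_quadratic_growth:
  assumes f: "midpoint_strongly_convex \<kappa> f" and min: "\<And>z. f m \<le> f z"
  shows "2 * \<kappa> * (dist x m)\<^sup>2 \<le> f x - f m"
proof -
  have "f m \<le> f (midpoint x m)" by (rule min)
  also have "\<dots> \<le> f x / 2 + f m / 2 - \<kappa> * (dist x m)\<^sup>2"
    using f unfolding midpoint_strongly_convex_def by blast
  finally show ?thesis by simp
qed

lemma arg_min_le:
  fixes f :: "'x \<Rightarrow> real"
  assumes "\<exists>m. \<forall>z. f m \<le> f z"
  shows "f (arg_min f (\<lambda>x. True)) \<le> f z"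
proof -
  obtain m where "\<And>z. f m \<le> f z" using assms by blast
  then have "\<forall>z. f (arg_min f (\<lambda>x. True)) \<le> f z"
    by (intro arg_minI[of _ m f "\<lambda>u. \<forall>z. f u \<le> f z"]) (auto simp: not_less)
  then show ?thesis by blast
qed

text \<open>Strong convexity between a point and the origin, combined with the lower bound, confines the
  sublevel set of the origin to a ball.\<close>

lemma midpoint_strongly_convex_attains_min:
  fixes f :: "'x::euclidean_space \<Rightarrow> real"
  assumes f: "midpoint_strongly_convex \<kappa> f" and "\<kappa> > 0"
    and cont: "continuous_on UNIV f" and below: "\<And>x. b \<le> f x"
  shows "\<exists>m. \<forall>z. f m \<le> f z"
proof -
  let ?L = "{x. f x \<le> f 0}"
  have "bounded ?L"
  proof (rule boundedI)
    fix x assume "x \<in> ?L"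
    have "b \<le> f (midpoint x 0)" by (rule below)
    also have "\<dots> \<le> f x / 2 + f 0 / 2 - \<kappa> * (dist x 0)\<^sup>2"
      using f unfolding midpoint_strongly_convex_def by blast
    finally have "\<kappa> * (norm x)\<^sup>2 \<le> f 0 - b"
      using \<open>x \<in> ?L\<close> by simp
    then have "(norm x)\<^sup>2 \<le> (f 0 - b) / \<kappa>"
      using \<open>\<kappa> > 0\<close> by (simp add: field_simps)
    then show "norm x \<le> sqrt ((f 0 - b) / \<kappa>)"
      by (rule real_le_rsqrt)
  qed
  moreover have "closed ?L"
    by (intro closed_Collect_le cont continuous_intros)
  ultimately have "compact ?L" by (simp add: compact_eq_bounded_closed)
  moreover have "?L \<noteq> {}" by blast
  ultimately obtain m where m: "m \<in> ?L" "\<And>z. z \<in> ?L \<Longrightarrow> f m \<le> f z"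
    using continuous_attains_inf[of ?L f] cont continuous_on_subset by blast
  have "f m \<le> f z" for z
    using m(2)[of z] m(1) by (cases "z \<in> ?L") auto
  then show ?thesis by blast
qed

lemma tendsto_of_sq_dist_le:
  fixes u :: "'a \<Rightarrow> 'x::metric_space"
  assumes "\<kappa> > 0" and "eventually (\<lambda>\<theta>. 2 * \<kappa> * (dist (u \<theta>) l)\<^sup>2 \<le> g \<theta>) F" and "(g \<longlongrightarrow> 0) F"
  shows "(u \<longlongrightarrow> l) F"
proof -
  have "((\<lambda>\<theta>. sqrt (g \<theta> / (2 * \<kappa>))) \<longlongrightarrow> sqrt (0 / (2 * \<kappa>))) F"
    by (intro tendsto_intros assms) (use \<open>\<kappa> > 0\<close> in auto)
  then have lim: "((\<lambda>\<theta>. sqrt (g \<theta> / (2 * \<kappa>))) \<longlongrightarrow> 0) F" by simp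
  have le: "eventually (\<lambda>\<theta>. dist (u \<theta>) l \<le> sqrt (g \<theta> / (2 * \<kappa>))) F"
    using assms(2)
  proof eventually_elim
    case (elim \<theta>)
    then have "(dist (u \<theta>) l)\<^sup>2 \<le> g \<theta> / (2 * \<kappa>)"
      using \<open>\<kappa> > 0\<close> by (simp add: field_simps)
    then show ?case by (rule real_le_rsqrt)
  qed
  have "((\<lambda>\<theta>. dist (u \<theta>) l) \<longlongrightarrow> 0) F"
    by (rule tendsto_sandwich[OF _ le tendsto_const lim]) auto
  then show ?thesis by (rule tendsto_dist_iff[THEN iffD2])
qed

section \<open>Mean, maximum and log-sum-exp of a finite family\<close>

definition mean_over :: "'s set \<Rightarrow> ('s \<Rightarrow> real) \<Rightarrow> real" where
  "mean_over S v = 1 / real (card S) * (\<Sum>\<sigma>\<in>S. v \<sigma>)"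

definition log_mean_exp :: "'s set \<Rightarrow> real \<Rightarrow> ('s \<Rightarrow> real) \<Rightarrow> real" where
  "log_mean_exp S \<theta> v = 1 / \<theta> * ln (mean_over S (\<lambda>\<sigma>. exp (\<theta> * v \<sigma>)))"

lemma mean_over_mono: "(\<And>\<sigma>. \<sigma> \<in> S \<Longrightarrow> v \<sigma> \<le> w \<sigma>) \<Longrightarrow> mean_over S v \<le> mean_over S w"
  unfolding mean_over_def by (intro mult_left_mono sum_mono) auto

lemma mean_over_cmult: "mean_over S (\<lambda>\<sigma>. c * v \<sigma>) = c * mean_over S v"
  unfolding mean_over_def by (simp add: sum_distrib_left)

lemma mean_over_add: "mean_over S (\<lambda>\<sigma>. v \<sigma> + w \<sigma>) = mean_over S v + mean_over S w"
  unfolding mean_over_def by (simp add: sum.distrib algebra_simps add_divide_distrib)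

context
  fixes S :: "'s set"
  assumes fin: "finite S" and ne: "S \<noteq> {}"
begin

lemma mean_over_const: "mean_over S (\<lambda>\<sigma>. c) = c"
  unfolding mean_over_def using fin ne by simp

lemma mean_over_exp_pos: "mean_over S (\<lambda>\<sigma>. exp (v \<sigma>)) > 0"
  unfolding mean_over_def using fin ne
  by (intro mult_pos_pos sum_pos) (auto simp: card_gt_0_iff)

text \<open>Jensen's inequality for the exponential, obtained by averaging \<open>1 + u \<le> exp u\<close> over the
  deviations \<open>u\<close> of \<open>\<theta> v\<close> from its mean.\<close>

lemma mean_le_log_mean_exp:
  assumes "\<theta> > 0"
  shows "mean_over S v \<le> log_mean_exp S \<theta> v"
proof -
  let ?m = "mean_over S v"
  have "1 = mean_over S (\<lambda>\<sigma>. (1 - \<theta> * ?m) + \<theta> * v \<sigma>)"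
    by (simp add: mean_over_add mean_over_cmult mean_over_const)
  also have "\<dots> \<le> mean_over S (\<lambda>\<sigma>. exp (- (\<theta> * ?m)) * exp (\<theta> * v \<sigma>))"
  proof (rule mean_over_mono)
    fix \<sigma>
    show "1 - \<theta> * ?m + \<theta> * v \<sigma> \<le> exp (- (\<theta> * ?m)) * exp (\<theta> * v \<sigma>)"
      using exp_ge_add_one_self[of "\<theta> * v \<sigma> - \<theta> * ?m"] by (simp add: exp_add[symmetric] algebra_simps)
  qed
  finally have "1 \<le> exp (- (\<theta> * ?m)) * mean_over S (\<lambda>\<sigma>. exp (\<theta> * v \<sigma>))"
    unfolding mean_over_cmult .
  then have "exp (\<theta> * ?m) \<le> mean_over S (\<lambda>\<sigma>. exp (\<theta> * v \<sigma>))"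
    by (simp add: exp_minus field_simps)
  then have "\<theta> * ?m \<le> ln (mean_over S (\<lambda>\<sigma>. exp (\<theta> * v \<sigma>)))"
    using mean_over_exp_pos by (simp add: ln_ge_iff)
  then show ?thesis
    unfolding log_mean_exp_def using assms by (simp add: field_simps)
qed

lemma log_mean_exp_mono:
  assumes "\<theta> > 0" and "\<And>\<sigma>. \<sigma> \<in> S \<Longrightarrow> v \<sigma> \<le> w \<sigma>"
  shows "log_mean_exp S \<theta> v \<le> log_mean_exp S \<theta> w"
  unfolding log_mean_exp_def using assms
  by (intro mult_left_mono) (auto simp: mean_over_exp_pos intro!: mean_over_mono)

lemma log_mean_exp_add_const:
  assumes "\<theta> \<noteq> 0"
  shows "log_mean_exp S \<theta> (\<lambda>\<sigma>. v \<sigma> + c) = log_mean_exp S \<theta> v + c"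
proof -
  have "mean_over S (\<lambda>\<sigma>. exp (\<theta> * (v \<sigma> + c))) = exp (\<theta> * c) * mean_over S (\<lambda>\<sigma>. exp (\<theta> * v \<sigma>))"
    by (simp add: mean_over_cmult[symmetric] exp_add[symmetric] algebra_simps)
  then show ?thesis
    unfolding log_mean_exp_def using mean_over_exp_pos[of "\<lambda>\<sigma>. \<theta> * v \<sigma>"] assms
    by (simp add: ln_mult field_simps)
qed

lemma log_mean_exp_le_Max:
  assumes "\<theta> > 0"
  shows "log_mean_exp S \<theta> v \<le> Max (v ` S)"
proof -
  have "log_mean_exp S \<theta> v \<le> log_mean_exp S \<theta> (\<lambda>\<sigma>. Max (v ` S))"
    using fin by (intro log_mean_exp_mono assms) auto
  also have "\<dots> = Max (v ` S)"
    using assms by (simp add: log_mean_exp_def mean_over_const)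
  finally show ?thesis .
qed

text \<open>The sum of the exponentials is at least its largest term; only the normalisation by the number of
  terms is lost.\<close>

lemma Max_le_log_mean_exp:
  assumes "\<theta> > 0"
  shows "Max (v ` S) \<le> log_mean_exp S \<theta> v + ln (real (card S)) / \<theta>"
proof -
  have N: "real (card S) > 0" using fin ne by (simp add: card_gt_0_iff)
  have "Max (v ` S) \<in> v ` S" using fin ne by simp
  then obtain \<sigma> where \<sigma>: "\<sigma> \<in> S" "Max (v ` S) = v \<sigma>" by blast
  have "exp (\<theta> * v \<sigma>) \<le> (\<Sum>\<sigma>\<in>S. exp (\<theta> * v \<sigma>))"
    using fin \<sigma> by (intro member_le_sum) auto
  also have "\<dots> = real (card S) * mean_over S (\<lambda>\<sigma>. exp (\<theta> * v \<sigma>))"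
    using N by (simp add: mean_over_def)
  finally have "\<theta> * v \<sigma> \<le> ln (real (card S) * mean_over S (\<lambda>\<sigma>. exp (\<theta> * v \<sigma>)))"
    using N mean_over_exp_pos by (simp add: ln_ge_iff)
  also have "\<dots> = ln (real (card S)) + ln (mean_over S (\<lambda>\<sigma>. exp (\<theta> * v \<sigma>)))"
    using N mean_over_exp_pos by (intro ln_mult_pos)
  finally show ?thesis
    unfolding log_mean_exp_def \<sigma> using assms by (simp add: field_simps)
qed

text \<open>The Cauchy-Schwarz inequality for the vectors \<open>exp (\<theta> v / 2)\<close> and \<open>exp (\<theta> w / 2)\<close>.\<close>

lemma log_mean_exp_midpoint:
  assumes "\<theta> > 0"
  shows "log_mean_exp S \<theta> (\<lambda>\<sigma>. v \<sigma> / 2 + w \<sigma> / 2) \<le> log_mean_exp S \<theta> v / 2 + log_mean_exp S \<theta> w / 2"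
proof -
  let ?E = "\<lambda>u. mean_over S (\<lambda>\<sigma>. exp (\<theta> * u \<sigma>))"
  let ?h = "\<lambda>u \<sigma>. exp (\<theta> * u \<sigma> / 2)"
  have sq: "(?h u \<sigma>)\<^sup>2 = exp (\<theta> * u \<sigma>)" for u :: "'s \<Rightarrow> real" and \<sigma>
    by (simp add: exp_double[symmetric])
  have "?E (\<lambda>\<sigma>. v \<sigma> / 2 + w \<sigma> / 2) = 1 / real (card S) * (\<Sum>\<sigma>\<in>S. ?h v \<sigma> * ?h w \<sigma>)"
    unfolding mean_over_def by (simp add: exp_add[symmetric] algebra_simps)
  then have "(?E (\<lambda>\<sigma>. v \<sigma> / 2 + w \<sigma> / 2))\<^sup>2 = (1 / real (card S))\<^sup>2 * (\<Sum>\<sigma>\<in>S. ?h v \<sigma> * ?h w \<sigma>)\<^sup>2"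
    by (simp add: power_divide)
  also have "\<dots> \<le> (1 / real (card S))\<^sup>2 * ((\<Sum>\<sigma>\<in>S. (?h v \<sigma>)\<^sup>2) * (\<Sum>\<sigma>\<in>S. (?h w \<sigma>)\<^sup>2))"
    by (intro mult_left_mono Cauchy_Schwarz_ineq_sum) auto
  also have "\<dots> = ?E v * ?E w"
    unfolding sq mean_over_def by (simp add: power2_eq_square)
  finally have "(?E (\<lambda>\<sigma>. v \<sigma> / 2 + w \<sigma> / 2))\<^sup>2 \<le> ?E v * ?E w" .
  then have "ln ((?E (\<lambda>\<sigma>. v \<sigma> / 2 + w \<sigma> / 2))\<^sup>2) \<le> ln (?E v * ?E w)"
    using mean_over_exp_pos[of "\<lambda>\<sigma>. \<theta> * (v \<sigma> / 2 + w \<sigma> / 2)"] by (intro ln_mono) auto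
  then have "2 * ln (?E (\<lambda>\<sigma>. v \<sigma> / 2 + w \<sigma> / 2)) \<le> ln (?E v) + ln (?E w)"
    using mean_over_exp_pos[of "\<lambda>\<sigma>. \<theta> * v \<sigma>"] mean_over_exp_pos[of "\<lambda>\<sigma>. \<theta> * w \<sigma>"]
      mean_over_exp_pos[of "\<lambda>\<sigma>. \<theta> * (v \<sigma> / 2 + w \<sigma> / 2)"]
    by (simp add: ln_mult ln_realpow)
  then show ?thesis
    unfolding log_mean_exp_def using assms by (simp add: field_simps)
qed

text \<open>The function is a difference quotient at 0 of \<open>\<theta> \<mapsto> ln (mean (exp (\<theta> v)))\<close>, whose value there is 0
  and whose derivative there is the mean of \<open>v\<close>.\<close>

lemma log_mean_exp_tendsto_mean: "((\<lambda>\<theta>. log_mean_exp S \<theta> v) \<longlongrightarrow> mean_over S v) (at 0)"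
proof -
  let ?L = "\<lambda>\<theta>. ln (mean_over S (\<lambda>\<sigma>. exp (\<theta> * v \<sigma>)))"
  have "((\<lambda>\<theta>. mean_over S (\<lambda>\<sigma>. exp (\<theta> * v \<sigma>))) has_real_derivative mean_over S v) (at 0)"
    unfolding mean_over_def using fin ne by (auto intro!: derivative_eq_intros simp: field_simps)
  then have "(?L has_real_derivative inverse (mean_over S (\<lambda>\<sigma>. exp (0 * v \<sigma>))) * mean_over S v) (at 0)"
    by (intro DERIV_chain2[OF DERIV_ln] mean_over_exp_pos)
  then have "(?L has_real_derivative mean_over S v) (at 0)"
    by (simp add: mean_over_const)
  then show ?thesis
    by (simp add: DERIV_def log_mean_exp_def mean_over_const)
qed

text \<open>Without the factor \<open>1 / \<theta>\<close>, changing the parameter changes each exponent by at most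
  \<open>\<bar>\<alpha> - \<beta>\<bar> M\<close>, and log-mean-exp passes this bound on.\<close>

lemma scaled_log_mean_exp_lipschitz:
  assumes v: "\<And>\<sigma>. \<sigma> \<in> S \<Longrightarrow> \<bar>v \<sigma>\<bar> \<le> M" and "\<alpha> > 0" "\<beta> > 0"
  shows "\<alpha> * log_mean_exp S \<alpha> v \<le> \<beta> * log_mean_exp S \<beta> v + \<bar>\<alpha> - \<beta>\<bar> * M"
proof -
  have "mean_over S (\<lambda>\<sigma>. exp (\<alpha> * v \<sigma>)) \<le> mean_over S (\<lambda>\<sigma>. exp (\<bar>\<alpha> - \<beta>\<bar> * M) * exp (\<beta> * v \<sigma>))"
  proof (rule mean_over_mono)
    fix \<sigma> assume "\<sigma> \<in> S"
    have "(\<alpha> - \<beta>) * v \<sigma> \<le> \<bar>\<alpha> - \<beta>\<bar> * \<bar>v \<sigma>\<bar>"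
      by (metis abs_ge_self abs_mult)
    also have "\<dots> \<le> \<bar>\<alpha> - \<beta>\<bar> * M"
      using v[OF \<open>\<sigma> \<in> S\<close>] by (intro mult_left_mono) auto
    finally show "exp (\<alpha> * v \<sigma>) \<le> exp (\<bar>\<alpha> - \<beta>\<bar> * M) * exp (\<beta> * v \<sigma>)"
      by (simp add: exp_add[symmetric] algebra_simps)
  qed
  then have "ln (mean_over S (\<lambda>\<sigma>. exp (\<alpha> * v \<sigma>)))
      \<le> ln (exp (\<bar>\<alpha> - \<beta>\<bar> * M) * mean_over S (\<lambda>\<sigma>. exp (\<beta> * v \<sigma>)))"
    unfolding mean_over_cmult by (intro ln_mono mean_over_exp_pos) auto
  also have "\<dots> = \<bar>\<alpha> - \<beta>\<bar> * M + ln (mean_over S (\<lambda>\<sigma>. exp (\<beta> * v \<sigma>)))"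
    using mean_over_exp_pos[of "\<lambda>\<sigma>. \<beta> * v \<sigma>"] by (simp add: ln_mult)
  finally show ?thesis
    unfolding log_mean_exp_def using assms by simp
qed

end

lemma continuous_on_Max_image:
  fixes f :: "'s \<Rightarrow> 'x::topological_space \<Rightarrow> real"
  assumes "finite S" "S \<noteq> {}" "\<And>\<sigma>. \<sigma> \<in> S \<Longrightarrow> continuous_on U (f \<sigma>)"
  shows "continuous_on U (\<lambda>x. Max ((\<lambda>\<sigma>. f \<sigma> x) ` S))"
  using assms
proof (induction S rule: finite_ne_induct)
  case (insert \<sigma> S)
  have "continuous_on U (\<lambda>x. max (f \<sigma> x) (Max ((\<lambda>\<sigma>. f \<sigma> x) ` S)))"
    using insert by (intro continuous_on_max) auto
  then show ?case using insert by simp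
qed simp

section \<open>Minimisers for a strongly convex family\<close>

locale strongly_convex_family =
  fixes S :: "'s set" and V :: "'s \<Rightarrow> 'x::euclidean_space \<Rightarrow> real" and \<kappa> b :: real
  assumes fin: "finite S" and ne: "S \<noteq> {}" and \<kappa>: "\<kappa> > 0"
    and cont: "\<And>\<sigma>. \<sigma> \<in> S \<Longrightarrow> continuous_on UNIV (V \<sigma>)"
    and below: "\<And>\<sigma> x. \<sigma> \<in> S \<Longrightarrow> b \<le> V \<sigma> x"
    and convex: "\<And>\<sigma>. \<sigma> \<in> S \<Longrightarrow> midpoint_strongly_convex \<kappa> (V \<sigma>)"
begin

abbreviation "mean_value x \<equiv> mean_over S (\<lambda>\<sigma>. V \<sigma> x)"
abbreviation "max_value x \<equiv> Max ((\<lambda>\<sigma>. V \<sigma> x) ` S)"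
abbreviation "soft_value \<theta> x \<equiv> log_mean_exp S \<theta> (\<lambda>\<sigma>. V \<sigma> x)"

abbreviation "mean_minimiser \<equiv> arg_min mean_value (\<lambda>x. True)"
abbreviation "max_minimiser \<equiv> arg_min max_value (\<lambda>x. True)"
abbreviation "soft_minimiser \<theta> \<equiv> arg_min (soft_value \<theta>) (\<lambda>x. True)"

lemma V_midpoint: "\<sigma> \<in> S \<Longrightarrow> V \<sigma> (midpoint x z) \<le> (V \<sigma> x / 2 + V \<sigma> z / 2) + (- \<kappa> * (dist x z)\<^sup>2)"
  using convex unfolding midpoint_strongly_convex_def by (metis add_uminus_conv_diff mult_minus_left)

lemma mean_value_convex: "midpoint_strongly_convex \<kappa> mean_value"
  unfolding midpoint_strongly_convex_def
proof (intro allI)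
  fix x z
  have "mean_value (midpoint x z)
      \<le> mean_over S (\<lambda>\<sigma>. (1 / 2 * V \<sigma> x + 1 / 2 * V \<sigma> z) + (- \<kappa> * (dist x z)\<^sup>2))"
    using V_midpoint by (intro mean_over_mono) simp
  also have "\<dots> = mean_value x / 2 + mean_value z / 2 - \<kappa> * (dist x z)\<^sup>2"
    unfolding mean_over_add mean_over_cmult mean_over_const[OF fin ne] by simp
  finally show "mean_value (midpoint x z) \<le> mean_value x / 2 + mean_value z / 2 - \<kappa> * (dist x z)\<^sup>2" .
qed

lemma max_value_convex: "midpoint_strongly_convex \<kappa> max_value"
  unfolding midpoint_strongly_convex_def
proof (intro allI)
  fix x z
  have "V \<sigma> (midpoint x z) \<le> max_value x / 2 + max_value z / 2 - \<kappa> * (dist x z)\<^sup>2" if "\<sigma> \<in> S" for \<sigma>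
  proof -
    have "V \<sigma> x \<le> max_value x" "V \<sigma> z \<le> max_value z" using fin that by auto
    then show ?thesis using V_midpoint[OF that, of x z] by linarith
  qed
  then show "max_value (midpoint x z) \<le> max_value x / 2 + max_value z / 2 - \<kappa> * (dist x z)\<^sup>2"
    using fin ne by simp
qed

lemma soft_value_convex:
  assumes "\<theta> > 0"
  shows "midpoint_strongly_convex \<kappa> (soft_value \<theta>)"
  unfolding midpoint_strongly_convex_def
proof (intro allI)
  fix x z
  have "soft_value \<theta> (midpoint x z)
      \<le> log_mean_exp S \<theta> (\<lambda>\<sigma>. (V \<sigma> x / 2 + V \<sigma> z / 2) + (- \<kappa> * (dist x z)\<^sup>2))"
    using V_midpoint by (intro log_mean_exp_mono fin ne assms)
  also have "\<dots> = log_mean_exp S \<theta> (\<lambda>\<sigma>. V \<sigma> x / 2 + V \<sigma> z / 2) - \<kappa> * (dist x z)\<^sup>2"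
    using assms by (subst log_mean_exp_add_const[OF fin ne]) auto
  also have "\<dots> \<le> soft_value \<theta> x / 2 + soft_value \<theta> z / 2 - \<kappa> * (dist x z)\<^sup>2"
    using log_mean_exp_midpoint[OF fin ne assms] by simp
  finally show "soft_value \<theta> (midpoint x z) \<le> soft_value \<theta> x / 2 + soft_value \<theta> z / 2 - \<kappa> * (dist x z)\<^sup>2" .
qed

lemma mean_value_ge: "b \<le> mean_value x"
  using mean_over_mono[of S "\<lambda>\<sigma>. b" "\<lambda>\<sigma>. V \<sigma> x"] below mean_over_const[OF fin ne] by simp

lemma mean_le_soft: "\<theta> > 0 \<Longrightarrow> mean_value x \<le> soft_value \<theta> x"
  by (rule mean_le_log_mean_exp[OF fin ne])

lemma soft_le_max: "\<theta> > 0 \<Longrightarrow> soft_value \<theta> x \<le> max_value x"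
  by (rule log_mean_exp_le_Max[OF fin ne])

lemma mean_minimiser_le: "mean_value mean_minimiser \<le> mean_value x"
proof (rule arg_min_le, rule midpoint_strongly_convex_attains_min[OF mean_value_convex \<kappa>])
  show "continuous_on UNIV mean_value"
    unfolding mean_over_def by (intro continuous_intros cont)
qed (rule mean_value_ge)

lemma max_minimiser_le: "max_value max_minimiser \<le> max_value x"
proof (rule arg_min_le, rule midpoint_strongly_convex_attains_min[OF max_value_convex \<kappa>])
  show "continuous_on UNIV max_value"
    by (intro continuous_on_Max_image fin ne cont)
  show "b \<le> max_value x" for x
    using mean_value_ge[of x] mean_le_soft[of 1 x] soft_le_max[of 1 x] by simp
qed

lemma soft_minimiser_le:
  assumes "\<theta> > 0"
  shows "soft_value \<theta> (soft_minimiser \<theta>) \<le> soft_value \<theta> x"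
proof (rule arg_min_le, rule midpoint_strongly_convex_attains_min[OF soft_value_convex[OF assms] \<kappa>])
  have "continuous_on UNIV (\<lambda>x. mean_over S (\<lambda>\<sigma>. exp (\<theta> * V \<sigma> x)))"
    unfolding mean_over_def by (intro continuous_intros cont)
  moreover have "mean_over S (\<lambda>\<sigma>. exp (\<theta> * V \<sigma> x)) \<noteq> 0" for x
    using mean_over_exp_pos[OF fin ne, of "\<lambda>\<sigma>. \<theta> * V \<sigma> x"] by simp
  ultimately show "continuous_on UNIV (soft_value \<theta>)"
    unfolding log_mean_exp_def by (intro continuous_intros) auto
  show "b \<le> soft_value \<theta> x" for x
    using mean_value_ge[of x] mean_le_soft[OF assms, of x] by simp
qed

text \<open>The right-hand side compares the two objectives only at the fixed point \<open>mean_minimiser\<close>, so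
  pointwise convergence of the objectives lets \<open>\<theta>\<close> tend to 0.\<close>

lemma soft_minimiser_near_mean:
  assumes "\<theta> > 0"
  shows "2 * \<kappa> * (dist (soft_minimiser \<theta>) mean_minimiser)\<^sup>2
    \<le> soft_value \<theta> mean_minimiser - mean_value mean_minimiser"
proof -
  have "2 * \<kappa> * (dist (soft_minimiser \<theta>) mean_minimiser)\<^sup>2
      \<le> mean_value (soft_minimiser \<theta>) - mean_value mean_minimiser"
    by (rule midpoint_strongly_convex_quadratic_growth[OF mean_value_convex mean_minimiser_le])
  also have "\<dots> \<le> soft_value \<theta> mean_minimiser - mean_value mean_minimiser"
    using mean_le_soft[OF assms, of "soft_minimiser \<theta>"] soft_minimiser_le[OF assms, of mean_minimiser]
    by linarith
  finally show ?thesis .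
qed

lemma soft_minimiser_tendsto_mean: "(soft_minimiser \<longlongrightarrow> mean_minimiser) (at_right 0)"
proof (rule tendsto_of_sq_dist_le[OF \<kappa>])
  show "\<forall>\<^sub>F \<theta> in at_right 0. 2 * \<kappa> * (dist (soft_minimiser \<theta>) mean_minimiser)\<^sup>2
      \<le> soft_value \<theta> mean_minimiser - mean_value mean_minimiser"
    using eventually_at_right_less[of 0] by eventually_elim (rule soft_minimiser_near_mean)
  have "((\<lambda>\<theta>. soft_value \<theta> mean_minimiser) \<longlongrightarrow> mean_value mean_minimiser) (at_right 0)"
    by (rule tendsto_within_subset[OF log_mean_exp_tendsto_mean[OF fin ne]]) simp
  then show "((\<lambda>\<theta>. soft_value \<theta> mean_minimiser - mean_value mean_minimiser) \<longlongrightarrow> 0) (at_right 0)"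
    by (rule LIM_zero)
qed

lemma soft_minimiser_tendsto_max: "(soft_minimiser \<longlongrightarrow> max_minimiser) at_top"
proof (rule tendsto_of_sq_dist_le[OF \<kappa>])
  show "\<forall>\<^sub>F \<theta> in at_top. 2 * \<kappa> * (dist (soft_minimiser \<theta>) max_minimiser)\<^sup>2 \<le> ln (real (card S)) / \<theta>"
    using eventually_gt_at_top[of 0]
  proof eventually_elim
    case (elim \<theta>)
    have "2 * \<kappa> * (dist (soft_minimiser \<theta>) max_minimiser)\<^sup>2
        \<le> max_value (soft_minimiser \<theta>) - max_value max_minimiser"
      by (rule midpoint_strongly_convex_quadratic_growth[OF max_value_convex max_minimiser_le])
    also have "\<dots> \<le> soft_value \<theta> (soft_minimiser \<theta>) + ln (real (card S)) / \<theta> - max_value max_minimiser"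
      using Max_le_log_mean_exp[OF fin ne elim, of "\<lambda>\<sigma>. V \<sigma> (soft_minimiser \<theta>)"] by simp
    also have "\<dots> \<le> ln (real (card S)) / \<theta>"
      using soft_minimiser_le[OF elim, of max_minimiser] soft_le_max[OF elim, of max_minimiser] by simp
    finally show ?case .
  qed
  show "((\<lambda>\<theta>. ln (real (card S)) / \<theta>) \<longlongrightarrow> 0) at_top"
    by (rule real_tendsto_divide_at_top[OF tendsto_const filterlim_ident])
qed

text \<open>Bounding the soft objective at \<open>mean_minimiser\<close> by the maximum gives a ball around
  \<open>mean_minimiser\<close>, independent of \<open>\<theta>\<close>, that contains all soft minimisers.\<close>

lemma soft_minimisers_uniformly_bounded:
  "\<exists>M. \<forall>\<theta>>0. \<forall>\<sigma>\<in>S. \<bar>V \<sigma> (soft_minimiser \<theta>)\<bar> \<le> M"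
proof -
  define \<rho> where "\<rho> = sqrt ((max_value mean_minimiser - mean_value mean_minimiser) / (2 * \<kappa>))"
  let ?K = "cball mean_minimiser \<rho>"
  have mem: "soft_minimiser \<theta> \<in> ?K" if "\<theta> > 0" for \<theta>
  proof -
    have "2 * \<kappa> * (dist (soft_minimiser \<theta>) mean_minimiser)\<^sup>2
        \<le> max_value mean_minimiser - mean_value mean_minimiser"
      using soft_minimiser_near_mean[OF that] soft_le_max[OF that, of mean_minimiser] by linarith
    then have "(dist (soft_minimiser \<theta>) mean_minimiser)\<^sup>2
        \<le> (max_value mean_minimiser - mean_value mean_minimiser) / (2 * \<kappa>)"
      using \<kappa> by (simp add: field_simps)
    then have "dist (soft_minimiser \<theta>) mean_minimiser \<le> \<rho>"
      unfolding \<rho>_def by (rule real_le_rsqrt)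
    then show ?thesis by (simp add: dist_commute)
  qed
  have "bounded (\<Union>\<sigma>\<in>S. V \<sigma> ` ?K)"
    using fin by (intro bounded_UN ballI compact_imp_bounded compact_continuous_image
        continuous_on_subset[OF cont]) auto
  then obtain M where M: "\<And>u. u \<in> (\<Union>\<sigma>\<in>S. V \<sigma> ` ?K) \<Longrightarrow> \<bar>u\<bar> \<le> M"
    by (auto simp: bounded_iff)
  have "\<bar>V \<sigma> (soft_minimiser \<theta>)\<bar> \<le> M" if "\<theta> > 0" "\<sigma> \<in> S" for \<theta> \<sigma>
    using M mem[OF that(1)] that(2) by blast
  then show ?thesis by blast
qed

text \<open>Both minimisers lie in the region where the values are bounded by \<open>M\<close>. Passing from parameter
  \<open>\<alpha>\<close> to \<open>\<theta>\<close> at \<open>soft_minimiser \<theta>\<close> and back at \<open>soft_minimiser \<alpha>\<close> costs \<open>\<bar>\<theta> - \<alpha>\<bar> M\<close> each time.\<close>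

lemma soft_minimiser_continuous: "continuous_on {0<..} soft_minimiser"
proof -
  obtain M where M: "\<And>\<theta> \<sigma>. \<theta> > 0 \<Longrightarrow> \<sigma> \<in> S \<Longrightarrow> \<bar>V \<sigma> (soft_minimiser \<theta>)\<bar> \<le> M"
    using soft_minimisers_uniformly_bounded by blast
  have near: "2 * \<kappa> * (dist (soft_minimiser \<theta>) (soft_minimiser \<alpha>))\<^sup>2 \<le> 2 * \<bar>\<theta> - \<alpha>\<bar> * M / \<alpha>"
    if "\<alpha> > 0" "\<theta> > 0" for \<alpha> \<theta>
  proof -
    let ?x = "soft_minimiser \<theta>" and ?a = "soft_minimiser \<alpha>"
    have "2 * \<kappa> * (dist ?x ?a)\<^sup>2 \<le> soft_value \<alpha> ?x - soft_value \<alpha> ?a"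
      using midpoint_strongly_convex_quadratic_growth[OF soft_value_convex soft_minimiser_le] that by blast
    then have "\<alpha> * (2 * \<kappa> * (dist ?x ?a)\<^sup>2) \<le> \<alpha> * (soft_value \<alpha> ?x - soft_value \<alpha> ?a)"
      using that by (intro mult_left_mono) auto
    moreover have "\<alpha> * soft_value \<alpha> ?x \<le> \<theta> * soft_value \<theta> ?x + \<bar>\<alpha> - \<theta>\<bar> * M"
      using M[OF that(2)] that by (intro scaled_log_mean_exp_lipschitz[OF fin ne]) auto
    moreover have "\<theta> * soft_value \<theta> ?a \<le> \<alpha> * soft_value \<alpha> ?a + \<bar>\<theta> - \<alpha>\<bar> * M"
      using M[OF that(1)] that by (intro scaled_log_mean_exp_lipschitz[OF fin ne]) auto
    moreover have "\<theta> * soft_value \<theta> ?x \<le> \<theta> * soft_value \<theta> ?a"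
      using soft_minimiser_le[OF that(2)] that by (intro mult_left_mono) auto
    ultimately have "\<alpha> * (2 * \<kappa> * (dist ?x ?a)\<^sup>2) \<le> 2 * \<bar>\<theta> - \<alpha>\<bar> * M"
      by (simp add: right_diff_distrib abs_minus_commute)
    then show ?thesis using that by (simp add: field_simps)
  qed
  have "(soft_minimiser \<longlongrightarrow> soft_minimiser \<alpha>) (at \<alpha> within {0<..})" if "\<alpha> > 0" for \<alpha>
  proof (rule tendsto_of_sq_dist_le[OF \<kappa>])
    show "\<forall>\<^sub>F \<theta> in at \<alpha> within {0<..}.
        2 * \<kappa> * (dist (soft_minimiser \<theta>) (soft_minimiser \<alpha>))\<^sup>2 \<le> 2 * \<bar>\<theta> - \<alpha>\<bar> * M / \<alpha>"
      using near[OF that] by (auto simp: eventually_at_filter)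
    have "((\<lambda>\<theta>. 2 * \<bar>\<theta> - \<alpha>\<bar> * M / \<alpha>) \<longlongrightarrow> 2 * \<bar>\<alpha> - \<alpha>\<bar> * M / \<alpha>) (at \<alpha> within {0<..})"
      using that by (intro tendsto_intros) auto
    then show "((\<lambda>\<theta>. 2 * \<bar>\<theta> - \<alpha>\<bar> * M / \<alpha>) \<longlongrightarrow> 0) (at \<alpha> within {0<..})" by simp
  qed
  then show ?thesis by (simp add: continuous_on_def)
qed

end

section \<open>The estimators of the filtering problem\<close>

text \<open>The parallelogram identity: the defect of convexity at the midpoint is exactly a quarter of the
  form at \<open>x - z\<close>.\<close>

lemma quadratic_midpoint_strongly_convex:
  fixes P :: "real^'n^'n"
  assumes \<mu>: "\<And>x. \<mu> * (x \<bullet> x) \<le> x \<bullet> (P *v x)"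
  shows "midpoint_strongly_convex (\<mu> / 4) (\<lambda>x. (x - m) \<bullet> (P *v (x - m)) + r)"
  unfolding midpoint_strongly_convex_def
proof (intro allI)
  fix x z
  define u w where "u = x - m" and "w = z - m"
  let ?q = "\<lambda>x. x \<bullet> (P *v x)"
  have mid: "midpoint x z - m = (1 / 2) *\<^sub>R (u + w)"
    by (simp add: midpoint_def u_def w_def vec_eq_iff field_simps)
  have "?q (midpoint x z - m) = ?q u / 2 + ?q w / 2 - ?q (u - w) / 4"
    unfolding mid
    by (simp add: matrix_vector_mult_scaleR matrix_vector_right_distrib matrix_vector_mult_diff_distrib
        inner_add_left inner_add_right inner_diff_left inner_diff_right field_simps)
  moreover have "\<mu> * (dist x z)\<^sup>2 \<le> ?q (u - w)"
    using \<mu>[of "x - z"] by (simp add: u_def w_def dist_norm dot_square_norm)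
  ultimately have "?q (midpoint x z - m) + r
      \<le> ?q u / 2 + ?q w / 2 + r - \<mu> / 4 * (dist x z)\<^sup>2"
    by simp
  then show "?q (midpoint x z - m) + r
      \<le> (?q (x - m) + r) / 2 + (?q (z - m) + r) / 2 - \<mu> / 4 * (dist x z)\<^sup>2"
    unfolding u_def w_def by (simp add: add_divide_distrib)
qed

lemma midpoint_strongly_convex_mono:
  fixes f :: "'x::real_normed_vector \<Rightarrow> real"
  assumes "midpoint_strongly_convex \<kappa> f" "\<kappa>' \<le> \<kappa>"
  shows "midpoint_strongly_convex \<kappa>' f"
  unfolding midpoint_strongly_convex_def
proof (intro allI)
  fix x z :: 'x
  have "\<kappa>' * (dist x z)\<^sup>2 \<le> \<kappa> * (dist x z)\<^sup>2"
    using assms(2) by (intro mult_right_mono) auto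
  then show "f (midpoint x z) \<le> f x / 2 + f z / 2 - \<kappa>' * (dist x z)\<^sup>2"
    using assms(1) unfolding midpoint_strongly_convex_def by (smt (verit, best))
qed

text \<open>The equation has the form treated above with \<open>K = C\<^sup>T Q\<inverse> C\<close>, symmetric because \<open>Q\<close> is, and
  \<open>W = B R B\<^sup>T\<close>, positive semidefinite because \<open>R\<close> is positive definite.\<close>

lemma riccati_solution_sym_pos_def:
  fixes C :: "real^'n^'r" and B :: "real^'m^'n"
  assumes ric: "riccati_solution T A B C \<Gamma> R Q X"
    and \<Gamma>: "sym_pos_def \<Gamma>" and R: "sym_pos_def R" and Q: "sym_pos_def Q"
    and t: "t \<in> {0..T}"
  shows "sym_pos_def (X t)"
proof (rule riccati_flow_pos_def[OF _ _ _ _ _ t])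
  let ?K = "transpose C ** matrix_inv Q ** C" and ?W = "B ** R ** transpose B"
  show "(X has_vector_derivative A ** X s + X s ** transpose A - X s ** ?K ** X s + ?W)
      (at s within {0..T})" if "s \<in> {0..T}" for s
    using ric that unfolding riccati_solution_def by (simp add: matrix_mul_assoc)
  show "transpose ?K = ?K"
    by (simp add: matrix_transpose_mul transpose_matrix_inv[OF Q] matrix_mul_assoc)
  show "transpose ?W = ?W"
    using R by (simp add: matrix_transpose_mul matrix_mul_assoc sym_pos_def_def)
  show "0 \<le> x \<bullet> (?W *v x)" for x
  proof -
    let ?z = "transpose B *v x"
    have "x \<bullet> (?W *v x) = ?z \<bullet> (R *v ?z)"
      using inner_transpose_matrix_vector[of x "transpose B" "R *v ?z"]
      by (simp only: matrix_vector_mul_assoc[symmetric] transpose_transpose)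
    moreover have "0 \<le> ?z \<bullet> (R *v ?z)"
      using R unfolding sym_pos_def_def by (cases "?z = 0") (auto intro: less_imp_le simp del: transpose_matrix_vector)
    ultimately show ?thesis by simp
  qed
  show "sym_pos_def (X 0)"
    using ric \<Gamma> by (simp add: riccati_solution_def)
qed

text \<open>The residual terms enter only as the additive constants \<open>r\<close>; finiteness of \<open>S\<close> makes the
  convexity modulus and the lower bound uniform.\<close>

lemma value_function_strongly_convex_family:
  fixes C :: "real^'n^'r" and Ric :: "'a \<times> 'g \<times> 'p \<times> 'q \<Rightarrow> real \<Rightarrow> real^'n^'n"
  assumes "finite S" "S \<noteq> {}" and spd: "\<And>\<sigma>. \<sigma> \<in> S \<Longrightarrow> sym_pos_def (Ric \<sigma> t)"
  shows "\<exists>\<kappa> b. strongly_convex_family S (\<lambda>\<sigma>. value_function C y Q Ric xh \<sigma> t) \<kappa> b"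
proof -
  let ?P = "\<lambda>\<sigma>. matrix_inv (Ric \<sigma> t)"
  let ?V = "\<lambda>\<sigma>. value_function C y Q Ric xh \<sigma> t"
  define r where "r \<sigma> = residual C y (Q (snd (snd (snd \<sigma>)))) (xh \<sigma>) t" for \<sigma>
  have V: "?V \<sigma> = (\<lambda>x. (x - xh \<sigma> t) \<bullet> (?P \<sigma> *v (x - xh \<sigma> t)) + r \<sigma>)" for \<sigma>
    by (cases \<sigma>) (simp add: value_function_def wnorm_sq_def r_def fun_eq_iff)
  have "\<forall>\<sigma>\<in>S. \<exists>\<mu>>0. \<forall>x. \<mu> * (x \<bullet> x) \<le> x \<bullet> (?P \<sigma> *v x)"
    using spd by (auto intro!: positive_quadratic_form_coercive matrix_inv_form_pos)
  then obtain \<mu> where \<mu>: "\<And>\<sigma>. \<sigma> \<in> S \<Longrightarrow> \<mu> \<sigma> > 0"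
      "\<And>\<sigma> x. \<sigma> \<in> S \<Longrightarrow> \<mu> \<sigma> * (x \<bullet> x) \<le> x \<bullet> (?P \<sigma> *v x)"
    by (metis (no_types, lifting))
  have "strongly_convex_family S ?V (Min ((\<lambda>\<sigma>. \<mu> \<sigma> / 4) ` S)) (Min (r ` S))"
  proof
    show "Min ((\<lambda>\<sigma>. \<mu> \<sigma> / 4) ` S) > 0"
      using assms(1,2) \<mu>(1) by simp
    fix \<sigma> assume \<sigma>: "\<sigma> \<in> S"
    show "continuous_on UNIV (?V \<sigma>)"
      unfolding V
      by (intro continuous_intros bounded_bilinear.continuous_on[OF bounded_bilinear_matrix_vector_mult])
    show "midpoint_strongly_convex (Min ((\<lambda>\<sigma>. \<mu> \<sigma> / 4) ` S)) (?V \<sigma>)"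
      unfolding V
      by (rule midpoint_strongly_convex_mono[OF quadratic_midpoint_strongly_convex[OF \<mu>(2)[OF \<sigma>]]])
        (use assms(1) \<sigma> in \<open>intro Min_le finite_imageI imageI\<close>)
    fix x
    have "0 \<le> \<mu> \<sigma> * ((x - xh \<sigma> t) \<bullet> (x - xh \<sigma> t))"
      using \<mu>(1)[OF \<sigma>] by simp
    also have "\<dots> \<le> (x - xh \<sigma> t) \<bullet> (?P \<sigma> *v (x - xh \<sigma> t))"
      by (rule \<mu>(2)[OF \<sigma>])
    finally have "r \<sigma> \<le> ?V \<sigma> x" unfolding V by simp
    moreover have "Min (r ` S) \<le> r \<sigma>" using assms(1) \<sigma> by simp
    ultimately show "Min (r ` S) \<le> ?V \<sigma> x" by linarith
  qed (use assms in auto)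
  then show ?thesis by blast
qed

theorem proposition4p1:
  fixes T t :: real
    and B :: "real^'m^'n" and C :: "real^'n^'r" and x0 :: "real^'n"
    and y :: "real \<Rightarrow> real^'r"
    and SA :: "'a set" and SG :: "'g set" and SR :: "'p set" and SQ :: "'q set"
    and A :: "'a \<Rightarrow> real^'n^'n" and \<Gamma> :: "'g \<Rightarrow> real^'n^'n"
    and R :: "'p \<Rightarrow> real^'m^'m" and Q :: "'q \<Rightarrow> real^'r^'r"
    and Ric :: "'a \<times> 'g \<times> 'p \<times> 'q \<Rightarrow> real \<Rightarrow> real^'n^'n"
    and xh :: "'a \<times> 'g \<times> 'p \<times> 'q \<Rightarrow> real \<Rightarrow> real^'n"
  assumes "T > 0" and "in_L2 T y"
    and "finite SA" "SA \<noteq> {}" and "finite SG" "SG \<noteq> {}"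
    and "finite SR" "SR \<noteq> {}" and "finite SQ" "SQ \<noteq> {}"
    and "\<And>g. g \<in> SG \<Longrightarrow> sym_pos_def (\<Gamma> g)"
    and "\<And>p. p \<in> SR \<Longrightarrow> sym_pos_def (R p)"
    and "\<And>q. q \<in> SQ \<Longrightarrow> sym_pos_def (Q q)"
    and "\<And>a g p q. (a, g, p, q) \<in> SA \<times> SG \<times> SR \<times> SQ \<Longrightarrow>
      riccati_solution T (A a) B C (\<Gamma> g) (R p) (Q q) (Ric (a, g, p, q))"
    and "\<And>a g p q. (a, g, p, q) \<in> SA \<times> SG \<times> SR \<times> SQ \<Longrightarrow>
      filter_solution T (A a) C (Q q) y x0 (Ric (a, g, p, q)) (xh (a, g, p, q))"
    and "t \<in> {0..T}"
  shows "let S = SA \<times> SG \<times> SR \<times> SQ; V = value_function C y Q Ric xh in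
    ((\<lambda>\<theta>. estimator S V \<theta> t) \<longlongrightarrow> estimator_zero S V t) (at_right 0) \<and>
    ((\<lambda>\<theta>. estimator S V \<theta> t) \<longlongrightarrow> estimator_infinity S V t) at_top \<and>
    continuous_on {0<..} (\<lambda>\<theta>. estimator S V \<theta> t)"
proof -
  define S where "S = SA \<times> SG \<times> SR \<times> SQ"
  define V where "V = value_function C y Q Ric xh"
  have "finite S" "S \<noteq> {}" using assms by (auto simp: S_def)
  moreover have "sym_pos_def (Ric \<sigma> t)" if "\<sigma> \<in> S" for \<sigma>
  proof -
    obtain a g p q where \<sigma>: "\<sigma> = (a, g, p, q)" by (cases \<sigma>)
    then have mem: "(a, g, p, q) \<in> SA \<times> SG \<times> SR \<times> SQ" using that S_def by simp
    have "g \<in> SG" "p \<in> SR" "q \<in> SQ" using mem by auto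
    then show ?thesis
      unfolding \<sigma> using assms
      by (intro riccati_solution_sym_pos_def[OF assms(14)[OF mem]]) auto
  qed
  ultimately obtain \<kappa> b where "strongly_convex_family S (\<lambda>\<sigma>. V \<sigma> t) \<kappa> b"
    unfolding V_def using value_function_strongly_convex_family by blast
  then interpret strongly_convex_family S "\<lambda>\<sigma>. V \<sigma> t" \<kappa> b .
  have eqs: "estimator_zero S V t = mean_minimiser" "estimator_infinity S V t = max_minimiser"
      "(\<lambda>\<theta>. estimator S V \<theta> t) = soft_minimiser"
    by (simp_all add: estimator_zero_def estimator_infinity_def estimator_def
        mean_over_def log_mean_exp_def)
  show ?thesis
    unfolding Let_def S_def[symmetric] V_def[symmetric] eqs
    using soft_minimiser_tendsto_mean soft_minimiser_tendsto_max soft_minimiser_continuous by blast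
qed

end
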